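(* $R(K_3, K_4, C_4, C_4) \ge 49$. Equivalently, there exists a $4$-coloring of the edges of $K_{48}$ with colors $1,2,3,4$ containing no triangle $K_3$ in color $1$, no $K_4$ in color $2$, no $4$-cycle $C_4$ in color $3$, and no $4$-cycle $C_4$ in color $4$ (a copy in color $i$ meaning a subgraph, not necessarily induced, all of whose edges have color $i$).
   Context: For graphs $G_1,\dots,G_k$, the multicolor Ramsey number $R(G_1,\dots,G_k)$ is the smallest $n$ such that every $k$-coloring of the edges of the complete graph $K_n$ (with colors $1,\dots,k$) contains, for some $i$, a copy of $G_i$ (as a not necessarily induced subgraph) all of whose edges have color $i$. $C_m$ denotes the cycle on $m$ vertices. *)

theory Defs
  imports "HOL-Library.Ramsey"
begin

type_synonym 'a graph = "'a set \<times> 'a set set"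

definition complete_graph :: "nat \<Rightarrow> nat graph" where
  "complete_graph n = ({..<n}, [{..<n}]\<^bsup>2\<^esup>)"

text \<open>A cycle only for \<open>m \<ge> 3\<close>.\<close>

definition cycle_graph :: "nat \<Rightarrow> nat graph" where
  "cycle_graph m = ({..<m}, {{i, Suc i mod m} |i. i < m})"

definition contains_copy :: "'b graph \<Rightarrow> 'a graph \<Rightarrow> bool" where
  "contains_copy H G \<longleftrightarrow>
    (\<exists>f. f \<in> fst G \<rightarrow> fst H \<and> inj_on f (fst G) \<and> (\<forall>e\<in>snd G. f ` e \<in> snd H))"

definition edge_coloring :: "nat \<Rightarrow> nat \<Rightarrow> (nat set \<Rightarrow> nat) \<Rightarrow> bool" where
  "edge_coloring k n c \<longleftrightarrow> c \<in> snd (complete_graph n) \<rightarrow> {1..k}"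

definition color_class :: "nat \<Rightarrow> (nat set \<Rightarrow> nat) \<Rightarrow> nat \<Rightarrow> nat graph" where
  "color_class n c i = (fst (complete_graph n), {e \<in> snd (complete_graph n). c e = i})"

text \<open>Colors are numbered from 1, list positions from 0. For finite simple graphs
  the minimum exists by Ramsey's theorem.\<close>

definition ramsey_number :: "'a graph list \<Rightarrow> nat" where
  "ramsey_number Gs = (LEAST n. \<forall>c. edge_coloring (length Gs) n c \<longrightarrow>
     (\<exists>i\<in>{1..length Gs}. contains_copy (color_class n c i) (Gs ! (i - 1))))"

end

theory Submission
  imports Defs
begin

text \<open>
  The coloring was found by computer search among perturbed blow-ups. A triangle-free 4-regular
  graph \<open>H\<close> on 12 vertices, with independence number 4 but only 18 independent 4-sets, is blown up
  by replacing each vertex by four; color 1 is exactly this blow-up. The pairs inside a part get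
  colors 3 and 4, the remaining pairs mostly color 2, so a \<open>K\<^sub>4\<close> in color 2 would have
  to be a transversal of one of the 18 independent 4-sets; a few edges of colors 3 and 4 between
  nonadjacent parts destroy all of these without closing a 4-cycle.
  The coloring is invariant under a semiregular cyclic group of order 6 and is therefore
  given by circulant blocks.
\<close>

section \<open>The 48 by 48 color matrix\<close>

text \<open>
  Vertex \<open>u\<close> lies in block \<open>u div 6\<close>, so there are 8 blocks. Row \<open>k\<close> holds the blocks
  \<open>(k, k), \<dots>, (k, 7)\<close>; a block \<open>(k, l)\<close> lists the colors by the difference modulo 6.
  The entry 0 marks the diagonal.
\<close>

definition words :: "nat list list list" where
  "words =
   [
    [[0,2,2,1,2,2], [4,2,2,1,2,2], [4,4,2,1,2,2], [3,3,2,1,2,2],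
     [2,3,2,1,1,1], [2,4,2,1,1,1], [3,2,2,1,1,1], [4,2,2,1,1,1]],
    [[0,2,2,1,2,2], [4,3,2,1,2,2], [4,4,2,1,2,2], [2,3,2,1,1,1],
     [2,3,2,1,1,1], [4,2,2,1,1,1], [3,2,2,1,1,1]],
    [[0,3,2,1,2,3], [3,2,2,1,2,2], [2,2,3,1,1,1], [2,2,4,1,1,1],
     [2,4,2,1,1,1], [2,2,2,1,1,1]],
    [[0,2,4,1,4,2], [2,2,4,1,1,1], [2,2,3,1,1,1], [2,3,2,1,1,1],
     [2,4,2,1,1,1]],
    [[0,2,2,1,2,2], [4,2,2,1,2,2], [4,4,2,1,2,2], [4,3,2,1,2,2]],
    [[0,2,2,1,2,2], [3,3,2,1,2,2], [4,4,2,1,2,2]],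
    [[0,2,4,1,4,2], [3,2,2,1,2,2]],
    [[0,3,2,1,2,3]]]"

text \<open>\<open>min\<close> and \<open>max\<close> make the color symmetric. Blocks start at
  multiples of 6, so the plain difference has the residue of the positions in the blocks. Diagonal
  blocks read the same at d and 6 - d, which makes the simultaneous rotation of all blocks an
  automorphism.\<close>

definition pair_color :: "nat \<Rightarrow> nat \<Rightarrow> nat" where
  "pair_color u v =
     words ! (min u v div 6) ! (max u v div 6 - min u v div 6) ! ((max u v - min u v) mod 6)"

definition color_matrix :: "nat list list" where
  "color_matrix = map (\<lambda>u. map (pair_color u) [0..<48]) [0..<48]"

section \<open>Executable checks\<close>

text \<open>
  The checkers below are first-order recursions with the matrix as an argument: symbolic
  evaluation normalizes it once and does not revisit it, as it would inside a closure.
\<close>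

fun pick :: "nat \<Rightarrow> nat list \<Rightarrow> nat list \<Rightarrow> nat list" where
  "pick c r [] = []"
| "pick c r (y # ys) = (if r ! y = c then y # pick c r ys else pick c r ys)"

fun clique_free :: "nat list list \<Rightarrow> nat \<Rightarrow> nat \<Rightarrow> nat list \<Rightarrow> bool" where
  "clique_free M c 0 ys = False"
| "clique_free M c (Suc k) [] = True"
| "clique_free M c (Suc k) (x # ys) =
     (clique_free M c k (pick c (M ! x) ys) \<and> clique_free M c (Suc k) ys)"

fun codegree_le_1 :: "nat list list \<Rightarrow> nat \<Rightarrow> nat list \<Rightarrow> nat list \<Rightarrow> bool" where
  "codegree_le_1 M c A [] = True"
| "codegree_le_1 M c A (y # ys) = (length (pick c (M ! y) A) \<le> 1 \<and> codegree_le_1 M c A ys)"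

text \<open>A 4-cycle amounts to two vertices with two common neighbors, so bounding codegrees
  replaces a search over quadruples.\<close>

fun C4_free :: "nat list list \<Rightarrow> nat \<Rightarrow> nat list \<Rightarrow> nat list \<Rightarrow> bool" where
  "C4_free M c vs [] = True"
| "C4_free M c vs (x # xs) = (codegree_le_1 M c (pick c (M ! x) vs) xs \<and> C4_free M c vs xs)"

text \<open>An edge of color 0 would be a clique of size 2 in that color, so
  \<open>clique_free M 0 2 vs\<close> together with the bound 4 confines edge colors to 1, ...,
  4.\<close>

definition certificate :: "nat list list \<Rightarrow> nat list \<Rightarrow> bool" where
  "certificate M vs \<longleftrightarrow> list_all (list_all (\<lambda>x. x \<le> 4)) M \<and> clique_free M 0 2 vs \<and>
     clique_free M 1 3 vs \<and> clique_free M 2 4 vs \<and> C4_free M 3 vs vs \<and> C4_free M 4 vs vs"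

lemma certificate_color_matrix: "certificate color_matrix [0..<48]"
  by code_simp

section \<open>Symmetry of the matrix and soundness of the checks\<close>

lemma pair_color_commute: "pair_color u v = pair_color v u"
  by (simp add: pair_color_def min.commute max.commute)

lemma nth_color_matrix: "u < 48 \<Longrightarrow> v < 48 \<Longrightarrow> color_matrix ! u ! v = pair_color u v"
  by (simp add: color_matrix_def)

lemma pick_eq_filter: "pick c r ys = filter (\<lambda>y. r ! y = c) ys"
  by (induction ys) auto

text \<open>If the head \<open>x\<close> lies in \<open>S\<close> and is joined to the rest of
  \<open>S\<close> in color \<open>c\<close>, that rest survives \<open>pick\<close>, and induction
  applies to it with size \<open>k\<close>. The pair comes out ordered because row \<open>x\<close>
  is only read at later list elements.\<close>

lemma clique_free_imp_nonadjacent_pair: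
  assumes "clique_free M c k ys" "sorted_wrt (<) ys" "S \<subseteq> set ys" "card S = k"
  shows "\<exists>x\<in>S. \<exists>y\<in>S. x < y \<and> M ! x ! y \<noteq> c"
  using assms
proof (induction M c k ys arbitrary: S rule: clique_free.induct)
  case (3 M c k x ys)
  show ?case
  proof (cases "x \<in> S")
    case False
    then have "S \<subseteq> set ys"
      using "3.prems"(3) by auto
    then show ?thesis
      using "3.IH"(2)[of S] "3.prems" by auto
  next
    case True
    let ?T = "S - {x}"
    have T: "?T \<subseteq> set ys" "card ?T = k"
      using "3.prems" True by auto
    show ?thesis
    proof (cases "\<exists>y\<in>?T. M ! x ! y \<noteq> c")
      case True
      then show ?thesis
        using "3.prems"(2) T(1) \<open>x \<in> S\<close> by fastforce
    next
      case False
      then have "?T \<subseteq> set (pick c (M ! x) ys)"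
        using T(1) by (auto simp: pick_eq_filter)
      moreover have "sorted_wrt (<) (pick c (M ! x) ys)"
        using "3.prems"(2) by (auto simp: pick_eq_filter sorted_wrt_filter)
      ultimately show ?thesis
        using "3.IH"(1)[of ?T] "3.prems"(1) T(2) by auto
    qed
  qed
qed auto

lemma length_le_1_imp_eq:
  assumes "length xs \<le> 1" "a \<in> set xs" "b \<in> set xs"
  shows "a = b"
  using assms by (cases xs) auto

lemma codegree_le_1_imp_eq:
  assumes "codegree_le_1 M c A ys" "y \<in> set ys" "a \<in> set A" "b \<in> set A"
    and "M ! y ! a = c" "M ! y ! b = c"
  shows "a = b"
  using assms
proof (induction M c A ys rule: codegree_le_1.induct)
  case (2 M c A z zs)
  then show ?case
    using length_le_1_imp_eq[of "pick c (M ! z) A" a b] by (auto simp: pick_eq_filter)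
qed auto

text \<open>Sortedness and \<open>x < y\<close> put \<open>y\<close> in the tail when
  \<open>x\<close> is the head, so this pair does get tested.\<close>

lemma C4_free_imp_eq:
  assumes "C4_free M c vs xs" "sorted_wrt (<) xs" "x \<in> set xs" "y \<in> set xs" "x < y"
    and "a \<in> set vs" "b \<in> set vs"
    and "M ! x ! a = c" "M ! x ! b = c" "M ! y ! a = c" "M ! y ! b = c"
  shows "a = b"
  using assms
proof (induction M c vs xs rule: C4_free.induct)
  case (2 M c vs z zs)
  show ?case
  proof (cases "x = z")
    case True
    with 2 have "codegree_le_1 M c (pick c (M ! x) vs) zs" "y \<in> set zs"
      by auto
    then show ?thesis
      by (rule codegree_le_1_imp_eq) (use 2 in \<open>auto simp: pick_eq_filter\<close>)
  next
    case False
    with 2 show ?thesis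
      by auto
  qed
qed auto

section \<open>The coloring of the edges of \<open>K_48\<close>\<close>

definition coloring :: "nat set \<Rightarrow> nat" where
  "coloring e = pair_color (Min e) (Max e)"

lemma coloring_pair: "coloring {u, v} = pair_color u v"
  by (auto simp: coloring_def pair_color_commute min_def max_def)

lemma coloring_pair_matrix:
  "u < 48 \<Longrightarrow> v < 48 \<Longrightarrow> coloring {u, v} = color_matrix ! u ! v"
  by (simp add: coloring_pair nth_color_matrix)

lemma edge_coloring_coloring: "edge_coloring 4 48 coloring"
  unfolding edge_coloring_def
proof
  fix e
  assume "e \<in> snd (complete_graph 48)"
  then obtain a b where "e = {a, b}" "a \<noteq> b" "a < 48" "b < 48"
    by (auto simp: complete_graph_def nsets_def card_2_iff)
  then obtain u v where e: "e = {u, v}" "u < v" "v < 48"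
    by (metis insert_commute linorder_neqE_nat)
  have "clique_free color_matrix 0 2 [0..<48]"
    using certificate_color_matrix by (simp add: certificate_def)
  then have "\<exists>x\<in>{u, v}. \<exists>y\<in>{u, v}. x < y \<and> color_matrix ! x ! y \<noteq> 0"
    by (rule clique_free_imp_nonadjacent_pair) (use e in auto)
  then have "pair_color u v \<noteq> 0"
    using e by (auto simp: nth_color_matrix)
  moreover have "list_all (list_all (\<lambda>x. x \<le> 4)) color_matrix"
    using certificate_color_matrix by (simp add: certificate_def)
  then have "pair_color u v \<le> 4"
    using e by (auto simp: list_all_iff color_matrix_def)
  ultimately show "coloring e \<in> {1..4}"
    using e by (simp add: coloring_pair)
qed

lemma no_clique_if_clique_free:
  assumes "clique_free color_matrix i m [0..<48]"
  shows "\<not> contains_copy (color_class 48 coloring i) (complete_graph m)"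
proof
  assume "contains_copy (color_class 48 coloring i) (complete_graph m)"
  then obtain f where f: "f \<in> {..<m} \<rightarrow> {..<48}" "inj_on f {..<m}"
    and col: "\<And>e. e \<in> [{..<m}]\<^bsup>2\<^esup> \<Longrightarrow> coloring (f ` e) = i"
    by (auto simp: contains_copy_def color_class_def complete_graph_def)
  have "\<exists>x\<in>f ` {..<m}. \<exists>y\<in>f ` {..<m}. x < y \<and> color_matrix ! x ! y \<noteq> i"
    using assms by (rule clique_free_imp_nonadjacent_pair) (use f in \<open>auto simp: card_image\<close>)
  then obtain a b where ab: "a < m" "b < m" "f a < f b" "color_matrix ! f a ! f b \<noteq> i"
    by auto
  then have "{a, b} \<in> [{..<m}]\<^bsup>2\<^esup>"
    by (auto simp: nsets_def card_2_iff)
  then have "coloring {f a, f b} = i"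
    using col by fastforce
  then show False
    using ab f(1) coloring_pair_matrix[of "f a" "f b"] by auto
qed

lemma no_C4_if_C4_free:
  assumes "C4_free color_matrix i [0..<48] [0..<48]"
  shows "\<not> contains_copy (color_class 48 coloring i) (cycle_graph 4)"
proof
  assume "contains_copy (color_class 48 coloring i) (cycle_graph 4)"
  then obtain f where f: "f \<in> {..<4} \<rightarrow> {..<48}" "inj_on f {..<4}"
    and edge: "\<forall>e\<in>{{j, Suc j mod 4} |j. j < 4}. coloring (f ` e) = i"
    by (auto simp: contains_copy_def color_class_def complete_graph_def cycle_graph_def)
  have col: "coloring (f ` {j, Suc j mod 4}) = i" if "j < 4" for j
    using edge that by blast
  have less: "f 0 < 48" "f 1 < 48" "f 2 < 48" "f 3 < 48"
    using f(1) by auto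
  \<comment> \<open>The two pairs of opposite vertices: \<open>f 1\<close> and \<open>f 3\<close>
    are common neighbors of \<open>f 0\<close> and \<open>f 2\<close>.\<close>
  have neq: "f 0 \<noteq> f 2" "f 1 \<noteq> f 3"
    using inj_onD[OF f(2), of 0 2] inj_onD[OF f(2), of 1 3] by auto
  have "coloring {f 0, f 1} = i" "coloring {f 1, f 2} = i"
    "coloring {f 2, f 3} = i" "coloring {f 3, f 0} = i"
    using col[of 0] col[of 1] col[of 2] col[of 3] by (simp_all flip: numeral_2_eq_2)
  then have edges: "pair_color (f 0) (f 1) = i" "pair_color (f 2) (f 1) = i"
    "pair_color (f 2) (f 3) = i" "pair_color (f 0) (f 3) = i"
    using pair_color_commute[of "f 1" "f 2"] pair_color_commute[of "f 3" "f 0"]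
    by (simp_all add: coloring_pair)
  \<comment> \<open>Stated for both orders, since either of \<open>f 0\<close> and
    \<open>f 2\<close> may be the smaller one.\<close>
  have "f 1 = f 3" if "{x, y} = {f 0, f 2}" "x < y" for x y
    by (rule C4_free_imp_eq[OF assms, of x y])
      (use that less edges in \<open>auto simp: nth_color_matrix doubleton_eq_iff\<close>)
  from this[of "f 0" "f 2"] this[of "f 2" "f 0"] show False
    using neq by (auto simp: neq_iff insert_commute)
qed

section \<open>Lower bounds for Ramsey numbers from colorings\<close>

lemma contains_copy_color_class_mono:
  assumes "contains_copy (color_class n c i) G" "n \<le> N"
  shows "contains_copy (color_class N c i) G"
proof -
  have "[{..<n}]\<^bsup>2\<^esup> \<subseteq> [{..<N}]\<^bsup>2\<^esup>"
    using assms(2) by (intro nsets_mono) auto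
  moreover obtain f where "f \<in> fst G \<rightarrow> {..<n}" "inj_on f (fst G)"
    "\<forall>e\<in>snd G. f ` e \<in> [{..<n}]\<^bsup>2\<^esup> \<and> c (f ` e) = i"
    using assms(1) by (auto simp: contains_copy_def color_class_def complete_graph_def)
  moreover from this(1) have "f \<in> fst G \<rightarrow> {..<N}"
    using assms(2) by (auto simp: Pi_iff intro: less_le_trans)
  ultimately show ?thesis
    by (auto simp: contains_copy_def color_class_def complete_graph_def intro!: exI[of _ f])
qed

text \<open>A monochromatic clique on \<open>m\<close> vertices contains every graph on
  \<open>m\<close> vertices, by any bijection. \<open>Suc\<close> translates between colors from 0
  and colors from 1.\<close>

lemma monochromatic_imp_contains_copy:
  assumes "monochromatic {..<n} m 2 g i" "\<And>e. e \<in> [{..<n}]\<^bsup>2\<^esup> \<Longrightarrow> c e = Suc (g e)"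
    and G: "fst G = {..<m}" "snd G \<subseteq> [{..<m}]\<^bsup>2\<^esup>"
  shows "contains_copy (color_class n c (Suc i)) G"
proof -
  obtain H where H: "H \<in> [{..<n}]\<^bsup>m\<^esup>" "g ` [H]\<^bsup>2\<^esup> \<subseteq> {i}"
    using assms(1) by (auto simp: monochromatic_def)
  then obtain f where f: "bij_betw f {..<m} H"
    by (auto simp: nsets_def) (metis bij_betw_from_nat_into_finite)
  have "f ` e \<in> [H]\<^bsup>2\<^esup>" if "e \<in> snd G" for e
  proof -
    have e: "e \<subseteq> {..<m}" "finite e" "card e = 2"
      using that G(2) by (auto simp: nsets_def)
    then have "inj_on f e" "f ` e \<subseteq> H"
      using f by (auto simp: bij_betw_def intro: inj_on_subset)
    with e show ?thesis
      by (simp add: nsets_def card_image)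
  qed
  moreover have "[H]\<^bsup>2\<^esup> \<subseteq> [{..<n}]\<^bsup>2\<^esup>"
    using H(1) by (intro nsets_mono) (auto simp: nsets_def)
  ultimately have "f ` e \<in> [{..<n}]\<^bsup>2\<^esup> \<and> c (f ` e) = Suc i" if "e \<in> snd G" for e
    using that H(2) assms(2) by fastforce
  moreover have "f \<in> {..<m} \<rightarrow> {..<n}" "inj_on f {..<m}"
    using f H(1) by (auto simp: bij_betw_def nsets_def)
  ultimately show ?thesis
    using G(1) by (auto simp: contains_copy_def color_class_def complete_graph_def)
qed

text \<open>Makes the \<open>LEAST\<close> in \<open>ramsey_number\<close> meaningful: Ramsey's
  theorem for cliques with as many vertices as the given graphs suffices.\<close>

lemma ex_ramsey_bound:
  fixes Gs :: "nat graph list"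
  assumes "length ms = length Gs"
    and G: "\<And>i. i < length Gs \<Longrightarrow> fst (Gs ! i) = {..<ms ! i}"
      "\<And>i. i < length Gs \<Longrightarrow> snd (Gs ! i) \<subseteq> [{..<ms ! i}]\<^bsup>2\<^esup>"
  shows "\<exists>n. \<forall>c. edge_coloring (length Gs) n c \<longrightarrow>
    (\<exists>i\<in>{1..length Gs}. contains_copy (color_class n c i) (Gs ! (i - 1)))"
proof -
  obtain n :: nat where n: "partn_lst {..<n} ms 2"
    using ramsey_full by blast
  have "\<exists>i\<in>{1..length Gs}. contains_copy (color_class n c i) (Gs ! (i - 1))"
    if c: "edge_coloring (length Gs) n c" for c
  proof -
    \<comment> \<open>Truncated subtraction loses nothing on edges, whose colors are at least 1 by
      \<open>range\<close>.\<close>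
    define g where "g e = c e - 1" for e
    have range: "c e \<in> {1..length Gs}" if "e \<in> [{..<n}]\<^bsup>2\<^esup>" for e
      using c that by (auto simp: edge_coloring_def complete_graph_def)
    then have "g \<in> [{..<n}]\<^bsup>2\<^esup> \<rightarrow> {..<length ms}"
      using assms(1) by (fastforce simp: g_def)
    then obtain i where i: "i < length Gs" "monochromatic {..<n} (ms ! i) 2 g i"
      using n assms(1) by (auto simp: partn_lst_def)
    have "contains_copy (color_class n c (Suc i)) (Gs ! i)"
      using i(2)
    proof (rule monochromatic_imp_contains_copy)
      show "c e = Suc (g e)" if "e \<in> [{..<n}]\<^bsup>2\<^esup>" for e
        using range[OF that] by (simp add: g_def)
    qed (use G i(1) in auto)
    then show ?thesis
      using i(1) by (intro bexI[of _ "Suc i"]) auto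
  qed
  then show ?thesis
    by blast
qed

text \<open>Were the minimum at most \<open>N\<close>, restricting \<open>c\<close> to that many
  vertices would yield a monochromatic copy, which is also one in \<open>K_N\<close>.\<close>

lemma ramsey_number_greater:
  fixes Gs :: "nat graph list"
  assumes "length ms = length Gs"
    and "\<And>i. i < length Gs \<Longrightarrow> fst (Gs ! i) = {..<ms ! i}"
      "\<And>i. i < length Gs \<Longrightarrow> snd (Gs ! i) \<subseteq> [{..<ms ! i}]\<^bsup>2\<^esup>"
    and c: "edge_coloring (length Gs) N c"
      "\<And>i. i \<in> {1..length Gs} \<Longrightarrow> \<not> contains_copy (color_class N c i) (Gs ! (i - 1))"
  shows "N < ramsey_number Gs"
proof (rule ccontr)
  assume "\<not> N < ramsey_number Gs"
  then have le: "ramsey_number Gs \<le> N"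
    by simp
  then have "[{..<ramsey_number Gs}]\<^bsup>2\<^esup> \<subseteq> [{..<N}]\<^bsup>2\<^esup>"
    by (intro nsets_mono) auto
  then have "edge_coloring (length Gs) (ramsey_number Gs) c"
    using c(1) by (auto simp: edge_coloring_def complete_graph_def)
  then obtain i where "i \<in> {1..length Gs}"
    "contains_copy (color_class (ramsey_number Gs) c i) (Gs ! (i - 1))"
    using LeastI_ex[OF ex_ramsey_bound[OF assms(1-3)]] unfolding ramsey_number_def by blast
  then show False
    using c(2) contains_copy_color_class_mono[OF _ le] by blast
qed

theorem theorem2:
  shows "ramsey_number [complete_graph 3, complete_graph 4, cycle_graph 4, cycle_graph 4] \<ge> 49 \<and>
    (\<exists>c. edge_coloring 4 48 c \<and>
         \<not> contains_copy (color_class 48 c 1) (complete_graph 3) \<and>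
         \<not> contains_copy (color_class 48 c 2) (complete_graph 4) \<and>
         \<not> contains_copy (color_class 48 c 3) (cycle_graph 4) \<and>
         \<not> contains_copy (color_class 48 c 4) (cycle_graph 4))"
proof -
  let ?Gs = "[complete_graph 3, complete_graph 4, cycle_graph 4, cycle_graph 4]"
  have cert: "clique_free color_matrix 1 3 [0..<48]" "clique_free color_matrix 2 4 [0..<48]"
    "C4_free color_matrix 3 [0..<48] [0..<48]" "C4_free color_matrix 4 [0..<48] [0..<48]"
    using certificate_color_matrix by (simp_all add: certificate_def)
  note avoid = no_clique_if_clique_free[OF cert(1)] no_clique_if_clique_free[OF cert(2)]
    no_C4_if_C4_free[OF cert(3)] no_C4_if_C4_free[OF cert(4)]
  \<comment> \<open>Each edge is a genuine 2-set because \<open>j\<close> and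
    \<open>Suc j mod 4\<close> differ; this places \<open>C_4\<close> inside
    \<open>K_4\<close>.\<close>
  have cycle: "snd (cycle_graph 4) \<subseteq> [{..<4}]\<^bsup>2\<^esup>"
    by (auto simp: cycle_graph_def nsets_def card_insert_if mod_Suc)
  have "48 < ramsey_number ?Gs"
  proof (rule ramsey_number_greater[where ms = "[3, 4, 4, 4]" and c = coloring])
    show "fst (?Gs ! i) = {..<[3, 4, 4, 4] ! i}" "snd (?Gs ! i) \<subseteq> [{..<[3, 4, 4, 4] ! i}]\<^bsup>2\<^esup>"
      if "i < length ?Gs" for i
    proof -
      from that consider "i = 0" | "i = 1" | "i = 2" | "i = 3"
        by fastforce
      then show "fst (?Gs ! i) = {..<[3, 4, 4, 4] ! i}" "snd (?Gs ! i) \<subseteq> [{..<[3, 4, 4, 4] ! i}]\<^bsup>2\<^esup>"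
        using cycle by (cases; simp add: complete_graph_def; simp add: cycle_graph_def)+
    qed
    show "\<not> contains_copy (color_class 48 coloring i) (?Gs ! (i - 1))" if "i \<in> {1..length ?Gs}" for i
    proof -
      from that consider "i = 1" | "i = 2" | "i = 3" | "i = 4"
        by fastforce
      then show ?thesis
        using avoid by cases simp_all
    qed
  qed (use edge_coloring_coloring in \<open>simp_all add: eval_nat_numeral\<close>)
  then show ?thesis
    using edge_coloring_coloring avoid by auto
qed

end
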